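(* Let $\Phi$ be a Schur idempotent on $\mathcal{B}(H)$. The following are equivalent: (i) $\operatorname{Ran}\Phi$ is hyperreflexive; (ii) $\Phi\in\mathfrak{H}$. Moreover, if these conditions hold then $\lambda(\Phi)\leq k(\Phi)\,\|\Phi^\perp\|$.
   Context: $H$ is a separable Hilbert space, $\mathcal{B}(H)$ is the space of bounded linear operators on $H$ with the operator norm, and $\mathcal{D}\subseteq\mathcal{B}(H)$ is a fixed maximal abelian selfadjoint algebra (masa). For a subspace $\mathcal{X}\subseteq\mathcal{B}(H)$ and $T\in\mathcal{B}(H)$, put $d(T,\mathcal{X})=\inf_{X\in\mathcal{X}}\|T-X\|$ and $\alpha(T,\mathcal{X})=\sup\{\inf_{X\in\mathcal{X}}\|T\xi-X\xi\| : \xi\in H,\ \|\xi\|=1\}$. A weak* closed subspace $\mathcal{X}$ is hyperreflexive if there is $k>0$ with $d(T,\mathcal{X})\leq k\,\alpha(T,\mathcal{X})$ for all $T\in\mathcal{B}(H)$; the least (infimal) such $k$ is denoted $k(\mathcal{X})$. A Schur multiplier is a weak* continuous $\mathcal{D}$-bimodule (linear) map on $\mathcal{B}(H)$; $\|\Phi\|$ denotes its norm as a linear map on the Banach space $\mathcal{B}(H)$. A Schur idempotent is a Schur multiplier $\Phi$ with $\Phi\circ\Phi=\Phi$; $\mathfrak{I}$ is the set of all Schur idempotents. Put $\Phi^\perp=\mathrm{id}-\Phi$, let $\operatorname{Ran}\Phi$ be the range of $\Phi$, and write $k(\Phi)=k(\operatorname{Ran}\Phi)$ when $\operatorname{Ran}\Phi$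 is hyperreflexive. $\mathfrak{H}$ is the set of $\Phi\in\mathfrak{I}$ for which there is $\lambda>0$ with $\|\Phi^\perp(T)\|\leq\lambda\,\alpha(T,\operatorname{Ran}\Phi)$ for all $T\in\mathcal{B}(H)$; the least (infimal) such $\lambda$ is denoted $\lambda(\Phi)$. *)

theory Defs
  imports "HOL-Analysis.Analysis"
begin

section \<open>Complex Hilbert spaces\<close>

class complex_vector = real_vector +
  fixes scaleC :: "complex \<Rightarrow> 'a \<Rightarrow> 'a"  (infixr "*\<^sub>C" 75)
  assumes scaleC_add_right: "c *\<^sub>C (x + y) = c *\<^sub>C x + c *\<^sub>C y"
    and scaleC_add_left: "(c + d) *\<^sub>C x = c *\<^sub>C x + d *\<^sub>C x"
    and scaleC_scaleC: "c *\<^sub>C (d *\<^sub>C x) = (c * d) *\<^sub>C x"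
    and scaleC_one: "1 *\<^sub>C x = x"
    and scaleR_scaleC: "r *\<^sub>R x = complex_of_real r *\<^sub>C x"

lemma vector_space_scaleC: "vector_space (scaleC :: complex \<Rightarrow> 'a::complex_vector \<Rightarrow> 'a)"
  by unfold_locales
    (simp_all add: scaleC_add_right scaleC_add_left scaleC_scaleC scaleC_one)

abbreviation csubspace :: "'a::complex_vector set \<Rightarrow> bool"
  where "csubspace \<equiv> module.subspace scaleC"

abbreviation clinear :: "('a::complex_vector \<Rightarrow> 'b::complex_vector) \<Rightarrow> bool"
  where "clinear \<equiv> Vector_Spaces.linear scaleC scaleC"

text \<open>The complex inner product is linear in its first argument. Its real part is the inner
  product of the underlying real Hilbert space, so that the norm satisfies
  \<open>norm x ^ 2 = Re (cinner x x)\<close>.\<close>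

class chilbert_space = complex_vector + real_inner + complete_space +
  fixes cinner :: "'a \<Rightarrow> 'a \<Rightarrow> complex"
  assumes cinner_add_left: "cinner (x + y) z = cinner x z + cinner y z"
    and cinner_scaleC_left: "cinner (c *\<^sub>C x) y = c * cinner x y"
    and cinner_commute: "cinner x y = cnj (cinner y x)"
    and Re_cinner: "Re (cinner x y) = inner x y"

lemma scaleC_zero_right: "c *\<^sub>C 0 = (0 :: 'a::complex_vector)"
  using scaleC_add_right[of c 0 "0 :: 'a"] by simp

lemma scaleC_minus_right: "c *\<^sub>C (- x) = - (c *\<^sub>C (x :: 'a::complex_vector))"
  using scaleC_add_right[of c x "- x"]
  by (simp add: scaleC_zero_right eq_neg_iff_add_eq_0 add.commute)

lemma scaleC_diff_right: "c *\<^sub>C (x - y) = c *\<^sub>C x - c *\<^sub>C (y :: 'a::complex_vector)"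
  using scaleC_add_right[of c x "- y"] by (simp add: scaleC_minus_right)

lemma scaleC_scaleR_commute:
  fixes x :: "'a::complex_vector"
  shows "c *\<^sub>C (r *\<^sub>R x) = r *\<^sub>R (c *\<^sub>C x)"
  by (simp add: scaleR_scaleC scaleC_scaleC mult.commute)

lemma inner_scaleC_scaleC:
  fixes x y :: "'h::chilbert_space"
  shows "inner (c *\<^sub>C x) (c *\<^sub>C y) = (cmod c)\<^sup>2 * inner x y"
proof -
  have "cinner (c *\<^sub>C x) (c *\<^sub>C y) = c * cinner x (c *\<^sub>C y)"
    by (rule cinner_scaleC_left)
  also have "cinner x (c *\<^sub>C y) = cnj (c * cinner y x)"
    by (subst cinner_commute) (simp only: cinner_scaleC_left)
  also have "\<dots> = cnj c * cinner x y"
    by (subst (2) cinner_commute) (simp only: complex_cnj_mult)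
  also have "c * (cnj c * cinner x y) = complex_of_real ((cmod c)\<^sup>2) * cinner x y"
    by (simp only: mult.assoc[symmetric] complex_norm_square)
  finally have "Re (cinner (c *\<^sub>C x) (c *\<^sub>C y)) = (cmod c)\<^sup>2 * Re (cinner x y)"
    by (simp only: Re_complex_of_real Im_complex_of_real times_complex.sel)
  then show ?thesis by (simp only: Re_cinner)
qed

lemma norm_scaleC: "norm (c *\<^sub>C x) = cmod c * norm (x :: 'h::chilbert_space)"
proof -
  have "(norm (c *\<^sub>C x))\<^sup>2 = (cmod c * norm x)\<^sup>2"
    by (simp only: power2_norm_eq_inner power_mult_distrib inner_scaleC_scaleC)
  then show ?thesis by simp
qed

lemma bounded_linear_scaleC: "bounded_linear (\<lambda>x :: 'h::chilbert_space. c *\<^sub>C x)"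
  by (rule bounded_linear_intro[of _ "cmod c"])
    (simp_all add: scaleC_add_right scaleC_scaleR_commute norm_scaleC mult.commute)

definition separable_hilbert :: "'h::chilbert_space itself \<Rightarrow> bool"
  where "separable_hilbert _ \<longleftrightarrow> (\<exists>A :: 'h set. countable A \<and> closure A = UNIV)"


section \<open>The space of bounded complex-linear operators\<close>

text \<open>\<open>'h bop\<close> consists of the complex-linear elements of the library type of bounded real-linear
  operators, from which it inherits the operator norm.\<close>

typedef (overloaded) 'h bop =
  "{T :: 'h::chilbert_space \<Rightarrow>\<^sub>L 'h. \<forall>c x. blinfun_apply T (c *\<^sub>C x) = c *\<^sub>C blinfun_apply T x}"
  by (rule exI[of _ 0]) (simp add: scaleC_zero_right)

setup_lifting type_definition_bop

lift_definition bop_apply :: "'h::chilbert_space bop \<Rightarrow> 'h \<Rightarrow> 'h" is blinfun_apply .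

instantiation bop :: (chilbert_space) real_normed_vector
begin

lift_definition zero_bop :: "'a bop" is 0
  by (simp add: scaleC_zero_right)
lift_definition plus_bop :: "'a bop \<Rightarrow> 'a bop \<Rightarrow> 'a bop" is "(+)"
  by (simp add: blinfun.add_left scaleC_add_right)
lift_definition uminus_bop :: "'a bop \<Rightarrow> 'a bop" is uminus
  by (simp add: blinfun.minus_left scaleC_minus_right)
lift_definition minus_bop :: "'a bop \<Rightarrow> 'a bop \<Rightarrow> 'a bop" is "(-)"
  by (simp add: blinfun.diff_left scaleC_diff_right)
lift_definition scaleR_bop :: "real \<Rightarrow> 'a bop \<Rightarrow> 'a bop" is "scaleR"
  by (simp add: blinfun.scaleR_left scaleC_scaleR_commute)
lift_definition norm_bop :: "'a bop \<Rightarrow> real" is norm .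
definition dist_bop :: "'a bop \<Rightarrow> 'a bop \<Rightarrow> real" where "dist_bop S T = norm (S - T)"
definition sgn_bop :: "'a bop \<Rightarrow> 'a bop" where "sgn_bop T = inverse (norm T) *\<^sub>R T"
definition uniformity_bop :: "('a bop \<times> 'a bop) filter"
  where "uniformity_bop = (INF e\<in>{0<..}. principal {(S, T). dist S T < e})"
definition open_bop :: "'a bop set \<Rightarrow> bool"
  where "open_bop U = (\<forall>S\<in>U. \<forall>\<^sub>F (S', T) in uniformity. S' = S \<longrightarrow> T \<in> U)"

instance
proof
  fix a b :: real and S T U :: "'a bop"
  show "S + T + U = S + (T + U)" by transfer (rule add.assoc)
  show "S + T = T + S" by transfer (rule add.commute)
  show "0 + S = S" by transfer (rule add_0_left)
  show "- S + S = 0" by transfer (rule left_minus)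
  show "S - T = S + - T" by transfer (rule diff_conv_add_uminus)
  show "a *\<^sub>R (S + T) = a *\<^sub>R S + a *\<^sub>R T" by transfer (rule scaleR_add_right)
  show "(a + b) *\<^sub>R S = a *\<^sub>R S + b *\<^sub>R S" by transfer (rule scaleR_add_left)
  show "a *\<^sub>R b *\<^sub>R S = (a * b) *\<^sub>R S" by transfer (rule scaleR_scaleR)
  show "1 *\<^sub>R S = S" by transfer (rule scaleR_one)
  show "norm S = 0 \<longleftrightarrow> S = 0" by transfer (rule norm_eq_zero)
  show "norm (S + T) \<le> norm S + norm T" by transfer (rule norm_triangle_ineq)
  show "norm (a *\<^sub>R S) = \<bar>a\<bar> * norm S" by transfer (rule norm_scaleR)
qed (rule dist_bop_def sgn_bop_def uniformity_bop_def open_bop_def)+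

end

lift_definition blinfun_scaleC :: "complex \<Rightarrow> 'h::chilbert_space \<Rightarrow>\<^sub>L 'h" is scaleC
  by (rule bounded_linear_scaleC)

instantiation bop :: (chilbert_space) complex_vector
begin

lift_definition scaleC_bop :: "complex \<Rightarrow> 'a bop \<Rightarrow> 'a bop"
  is "\<lambda>c T. blinfun_scaleC c o\<^sub>L T"
  by (simp add: blinfun_scaleC.rep_eq scaleC_scaleC mult.commute)

instance
proof
  fix c d :: complex and r :: real and S T :: "'a bop"
  show "c *\<^sub>C (S + T) = c *\<^sub>C S + c *\<^sub>C T"
    by transfer (rule blinfun_eqI,
      simp only: blinfun_apply_blinfun_compose blinfun_scaleC.rep_eq blinfun.add_left scaleC_add_right)
  show "(c + d) *\<^sub>C S = c *\<^sub>C S + d *\<^sub>C S"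
    by transfer (rule blinfun_eqI,
      simp only: blinfun_apply_blinfun_compose blinfun_scaleC.rep_eq blinfun.add_left scaleC_add_left)
  show "c *\<^sub>C d *\<^sub>C S = (c * d) *\<^sub>C S"
    by transfer (rule blinfun_eqI, simp only: blinfun_apply_blinfun_compose blinfun_scaleC.rep_eq scaleC_scaleC)
  show "1 *\<^sub>C S = S"
    by transfer (rule blinfun_eqI, simp only: blinfun_apply_blinfun_compose blinfun_scaleC.rep_eq scaleC_one)
  show "r *\<^sub>R S = complex_of_real r *\<^sub>C S"
    by transfer (rule blinfun_eqI,
      simp only: blinfun_apply_blinfun_compose blinfun_scaleC.rep_eq blinfun.scaleR_left scaleR_scaleC)
qed

end

lift_definition bop_compose :: "'h::chilbert_space bop \<Rightarrow> 'h bop \<Rightarrow> 'h bop"  (infixl "\<cdot>" 70)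
  is blinfun_compose by simp


section \<open>Maximal abelian selfadjoint algebras\<close>

definition is_adjoint :: "'h::chilbert_space bop \<Rightarrow> 'h bop \<Rightarrow> bool"
  where "is_adjoint S T \<longleftrightarrow> (\<forall>x y. cinner (bop_apply T x) y = cinner x (bop_apply S y))"

definition abelian_selfadjoint_algebra :: "'h::chilbert_space bop set \<Rightarrow> bool"
  where "abelian_selfadjoint_algebra \<A> \<longleftrightarrow>
    csubspace \<A> \<and>
    (\<forall>S\<in>\<A>. \<forall>T\<in>\<A>. S \<cdot> T \<in> \<A>) \<and>
    (\<forall>T\<in>\<A>. \<exists>S\<in>\<A>. is_adjoint S T) \<and>
    (\<forall>S\<in>\<A>. \<forall>T\<in>\<A>. S \<cdot> T = T \<cdot> S)"

definition masa :: "'h::chilbert_space bop set \<Rightarrow> bool"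
  where "masa \<D> \<longleftrightarrow> abelian_selfadjoint_algebra \<D> \<and>
    (\<forall>\<E>. abelian_selfadjoint_algebra \<E> \<and> \<D> \<subseteq> \<E> \<longrightarrow> \<E> = \<D>)"


section \<open>The weak* topology\<close>

text \<open>The predual of the space of bounded operators is the trace class, paired with it by
  \<open>(T, A) \<mapsto> trace (T A)\<close>. The trace-class operators are exactly the sums of the rank-one operators
  \<open>z \<mapsto> cinner z (y n) *\<^sub>C x n\<close> with square-summable sequences \<open>x\<close> and \<open>y\<close>, and such a sum
  induces the functional below.\<close>

definition normal_functionals :: "('h::chilbert_space bop \<Rightarrow> complex) set"
  where "normal_functionals =
    {\<lambda>T. \<Sum>n. cinner (bop_apply T (x n)) (y n) | x y :: nat \<Rightarrow> 'h.
      summable (\<lambda>n. (norm (x n))\<^sup>2) \<and> summable (\<lambda>n. (norm (y n))\<^sup>2)}"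

definition weak_star :: "'h::chilbert_space bop topology"
  where "weak_star =
    topology_generated_by {\<omega> -` U | \<omega> U. \<omega> \<in> normal_functionals \<and> open U}"


section \<open>Hyperreflexivity\<close>

definition op_dist :: "'h::chilbert_space bop \<Rightarrow> 'h bop set \<Rightarrow> real"
  where "op_dist T \<X> = (INF X\<in>\<X>. norm (T - X))"

text \<open>Inserting \<open>0\<close> does not affect the supremum of nonnegative numbers; it only makes it \<open>0\<close>
  when there are no unit vectors.\<close>

definition arveson_dist :: "'h::chilbert_space bop \<Rightarrow> 'h bop set \<Rightarrow> real"
  where "arveson_dist T \<X> =
    Sup (insert 0 {INF X\<in>\<X>. norm (bop_apply T \<xi> - bop_apply X \<xi>) | \<xi>. norm \<xi> = 1})"

definition hyperreflexive :: "'h::chilbert_space bop set \<Rightarrow> bool"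
  where "hyperreflexive \<X> \<longleftrightarrow> csubspace \<X> \<and> closedin weak_star \<X> \<and>
    (\<exists>k>0. \<forall>T. op_dist T \<X> \<le> k * arveson_dist T \<X>)"

definition hyperreflexivity_const :: "'h::chilbert_space bop set \<Rightarrow> real"
  where "hyperreflexivity_const \<X> =
    Inf {k. k > 0 \<and> (\<forall>T. op_dist T \<X> \<le> k * arveson_dist T \<X>)}"


section \<open>Schur idempotents\<close>

definition schur_multipliers ::
    "'h::chilbert_space bop set \<Rightarrow> ('h bop \<Rightarrow> 'h bop) set"
  where "schur_multipliers \<D> = {\<Phi>. clinear \<Phi> \<and> continuous_map weak_star weak_star \<Phi> \<and>
    (\<forall>A\<in>\<D>. \<forall>T. \<Phi> (A \<cdot> T) = A \<cdot> \<Phi> T \<and> \<Phi> (T \<cdot> A) = \<Phi> T \<cdot> A)}"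

definition schur_idempotents ::
    "'h::chilbert_space bop set \<Rightarrow> ('h bop \<Rightarrow> 'h bop) set"
  where "schur_idempotents \<D> = {\<Phi> \<in> schur_multipliers \<D>. \<Phi> \<circ> \<Phi> = \<Phi>}"

definition perp :: "('h::chilbert_space bop \<Rightarrow> 'h bop) \<Rightarrow> 'h bop \<Rightarrow> 'h bop"
  where "perp \<Phi> = (\<lambda>T. T - \<Phi> T)"

definition k_const :: "('h::chilbert_space bop \<Rightarrow> 'h bop) \<Rightarrow> real"
  where "k_const \<Phi> = hyperreflexivity_const (range \<Phi>)"

definition frak_H :: "'h::chilbert_space bop set \<Rightarrow> ('h bop \<Rightarrow> 'h bop) set"
  where "frak_H \<D> = {\<Phi> \<in> schur_idempotents \<D>.
    \<exists>l>0. \<forall>T. norm (perp \<Phi> T) \<le> l * arveson_dist T (range \<Phi>)}"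

definition lambda_const :: "('h::chilbert_space bop \<Rightarrow> 'h bop) \<Rightarrow> real"
  where "lambda_const \<Phi> =
    Inf {l. l > 0 \<and> (\<forall>T. norm (perp \<Phi> T) \<le> l * arveson_dist T (range \<Phi>))}"

end

theory Submission
  imports Defs
begin

text \<open>For a Schur idempotent \<open>\<Phi>\<close> with range \<open>\<X>\<close>, the map \<open>\<Phi>\<^sup>\<perp>\<close> annihilates \<open>\<X>\<close>, so
  \<open>d(T, \<X>) \<le> \<parallel>\<Phi>\<^sup>\<perp>(T)\<parallel> \<le> \<parallel>\<Phi>\<^sup>\<perp>\<parallel> d(T, \<X>)\<close>, and both claims follow by comparing with
  \<open>\<alpha>(T, \<X>)\<close>. The point to be supplied is that \<open>\<Phi>\<^sup>\<perp>\<close> is norm bounded: the sets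
  \<open>{T. \<parallel>\<Phi>(T)\<parallel> \<le> n}\<close> are weak* closed, hence norm closed, and they cover the space, so by
  Baire's theorem one of them contains a ball.\<close>

section \<open>Complex inner products and the operator norm\<close>

lemma cmod_cinner_le: "cmod (cinner x y) \<le> norm x * norm (y :: 'h::chilbert_space)"
proof (cases "cinner x y = 0")
  case False
  \<comment> \<open>A unimodular phase rotating \<open>cinner x y\<close> onto the nonnegative real
    axis, where it agrees with the real \<open>inner\<close> and the real Cauchy-Schwarz inequality
    applies.\<close>
  define c where "c = cnj (cinner x y) / cmod (cinner x y)"
  have c: "cmod c = 1"
    using False by (simp add: c_def norm_divide)
  have "cinner (c *\<^sub>C x) y = (cinner x y * cnj (cinner x y)) / cmod (cinner x y)"
    by (simp only: cinner_scaleC_left c_def times_divide_eq_right mult.commute)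
  also have "\<dots> = cmod (cinner x y)"
    using False by (simp only: complex_norm_square[symmetric]) (simp add: power2_eq_square)
  finally have "cinner (c *\<^sub>C x) y = cmod (cinner x y)" .
  then have "cmod (cinner x y) = inner (c *\<^sub>C x) y"
    using Re_cinner[of "c *\<^sub>C x" y] by simp
  also have "\<dots> \<le> norm (c *\<^sub>C x) * norm y"
    by (rule norm_cauchy_schwarz)
  finally show ?thesis
    by (simp add: norm_scaleC c)
qed simp

lemma cinner_scaleR_left: "cinner (r *\<^sub>R x) y = r *\<^sub>R cinner x (y :: 'h::chilbert_space)"
  by (simp add: scaleR_scaleC cinner_scaleC_left scaleR_conv_of_real)

lemma cinner_diff_left: "cinner (x - z) y = cinner x y - cinner z (y :: 'h::chilbert_space)"
  using cinner_add_left[of "x - z" z y] by (simp add: algebra_simps)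

lemma cinner_zero_left [simp]: "cinner 0 (y :: 'h::chilbert_space) = 0"
  using cinner_diff_left[of 0 0 y] by simp

lemma cinner_eqI: "x = z" if "\<And>y. cinner x y = cinner z (y :: 'h::chilbert_space)"
proof -
  have "inner (x - z) (x - z) = 0"
    using that[of "x - z"] by (simp add: cinner_diff_left flip: Re_cinner)
  then show ?thesis by simp
qed

lemma bop_apply_add: "bop_apply (S + T) x = bop_apply S x + bop_apply T x"
  by transfer (rule blinfun.add_left)

lemma bop_apply_scaleR: "bop_apply (r *\<^sub>R T) x = r *\<^sub>R bop_apply T x"
  by transfer (rule blinfun.scaleR_left)

lemma bop_apply_zero [simp]: "bop_apply 0 x = 0"
  by transfer simp

lemma norm_bop_apply_le: "norm (bop_apply T x) \<le> norm T * norm x"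
  by transfer (rule norm_blinfun)

lemma norm_bop_bound: "norm T \<le> b" if "0 \<le> b" "\<And>x. norm (bop_apply T x) \<le> b * norm x"
  using that by transfer (rule norm_blinfun_bound)

lemma bop_eqI: "S = T" if "\<And>x. bop_apply S x = bop_apply T x"
  using that by transfer (rule blinfun_eqI)

lemma dist_Rep_bop: "dist (Rep_bop S) (Rep_bop T) = dist S T"
  by (simp add: dist_norm norm_bop.rep_eq minus_bop.rep_eq)

section \<open>Completeness of \<open>'h bop\<close>, and its norm through matrix
  coefficients\<close>

instance chilbert_space \<subseteq> banach ..

text \<open>Complex-linearity survives norm limits, so completeness passes down from the bounded
  real-linear operators. Baire's theorem will rely on it.\<close>

instance bop :: (chilbert_space) banach
proof
  fix X :: "nat \<Rightarrow> 'a bop"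
  assume "Cauchy X"
  then have "Cauchy (\<lambda>n. Rep_bop (X n))"
    by (simp add: Cauchy_def dist_Rep_bop)
  from Cauchy_convergent[OF this] obtain L where L: "(\<lambda>n. Rep_bop (X n)) \<longlonglongrightarrow> L"
    unfolding convergent_def ..
  have "blinfun_apply L (c *\<^sub>C x) = c *\<^sub>C blinfun_apply L x" for c x
  proof (rule LIMSEQ_unique)
    show "(\<lambda>n. blinfun_apply (Rep_bop (X n)) (c *\<^sub>C x)) \<longlonglongrightarrow> blinfun_apply L (c *\<^sub>C x)"
      by (rule blinfun.tendsto[OF L tendsto_const])
    have "blinfun_apply (Rep_bop (X n)) (c *\<^sub>C x) = c *\<^sub>C blinfun_apply (Rep_bop (X n)) x" for n
      using Rep_bop[of "X n"] by simp
    moreover have "(\<lambda>n. c *\<^sub>C blinfun_apply (Rep_bop (X n)) x) \<longlonglongrightarrow> c *\<^sub>C blinfun_apply L x"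
      by (rule bounded_linear.tendsto[OF bounded_linear_scaleC blinfun.tendsto[OF L tendsto_const]])
    ultimately show "(\<lambda>n. blinfun_apply (Rep_bop (X n)) (c *\<^sub>C x)) \<longlonglongrightarrow> c *\<^sub>C blinfun_apply L x"
      by (simp only:)
  qed
  then have "Rep_bop (Abs_bop L) = L"
    by (simp add: Abs_bop_inverse)
  then have "X \<longlonglongrightarrow> Abs_bop L"
    using L by (simp add: tendsto_iff flip: dist_Rep_bop)
  then show "convergent X"
    by (rule convergentI)
qed

text \<open>Splits a norm bound into conditions on single coefficients, each of them weak*
  continuous in \<open>T\<close>. The converse direction tests with \<open>y = bop_apply T x\<close>
  and cancels one factor.\<close>

lemma norm_bop_le_iff:
  assumes "0 \<le> b"
  shows "norm T \<le> b \<longleftrightarrow> (\<forall>x y. cmod (cinner (bop_apply T x) y) \<le> b * norm x * norm y)"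
proof (intro iffI allI)
  fix x y
  assume "norm T \<le> b"
  have "cmod (cinner (bop_apply T x) y) \<le> norm (bop_apply T x) * norm y"
    by (rule cmod_cinner_le)
  also have "\<dots> \<le> b * norm x * norm y"
    using norm_bop_apply_le[of T x] \<open>norm T \<le> b\<close>
    by (intro mult_right_mono order_trans[OF norm_bop_apply_le]) auto
  finally show "cmod (cinner (bop_apply T x) y) \<le> b * norm x * norm y" .
next
  assume *: "\<forall>x y. cmod (cinner (bop_apply T x) y) \<le> b * norm x * norm y"
  show "norm T \<le> b"
  proof (rule norm_bop_bound[OF assms])
    fix x
    let ?z = "bop_apply T x"
    have "norm ?z * norm ?z = Re (cinner ?z ?z)"
      by (simp add: Re_cinner flip: power2_norm_eq_inner power2_eq_square)
    also have "\<dots> \<le> cmod (cinner ?z ?z)"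
      by (rule complex_Re_le_cmod)
    also have "\<dots> \<le> b * norm x * norm ?z"
      using * by blast
    finally show "norm ?z \<le> b * norm x"
      using assms by (cases "?z = 0") auto
  qed
qed

section \<open>The weak* topology compared with the norm topology\<close>

lemma bounded_linear_normal_functional:
  assumes "\<omega> \<in> normal_functionals"
  shows "bounded_linear \<omega>"
proof -
  obtain x y where \<omega>: "\<omega> = (\<lambda>T. \<Sum>n. cinner (bop_apply T (x n)) (y n))"
    and x: "summable (\<lambda>n. (norm (x n))\<^sup>2)" and y: "summable (\<lambda>n. (norm (y n))\<^sup>2)"
    using assms unfolding normal_functionals_def by blast
  \<comment> \<open>Square-summability of both sequences gives absolute convergence, since
    \<open>2 * a * b\<close> is at most the sum of the squares.\<close>
  have xy: "summable (\<lambda>n. norm (x n) * norm (y n))"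
  proof (rule summable_comparison_test'[OF summable_add[OF x y]])
    fix n
    show "norm (norm (x n) * norm (y n)) \<le> (norm (x n))\<^sup>2 + (norm (y n))\<^sup>2"
      using sum_squares_bound[of "norm (x n)" "norm (y n)"]
        mult_nonneg_nonneg[OF norm_ge_zero norm_ge_zero, of "x n" "y n"]
      unfolding real_norm_def abs_mult abs_norm_cancel by linarith
  qed
  have bound: "cmod (cinner (bop_apply T (x n)) (y n)) \<le> norm T * (norm (x n) * norm (y n))" for T n
    using norm_bop_le_iff[of "norm T" T] by (simp add: mult.assoc)
  have sm: "summable (\<lambda>n. cinner (bop_apply T (x n)) (y n))" for T
    by (rule summable_comparison_test'[OF summable_mult[OF xy]]) (rule bound)
  show ?thesis
  proof (rule bounded_linear_intro)
    fix S T r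
    show "\<omega> (S + T) = \<omega> S + \<omega> T"
      using suminf_add[OF sm sm, of S T] by (simp add: \<omega> bop_apply_add cinner_add_left)
    show "\<omega> (r *\<^sub>R T) = r *\<^sub>R \<omega> T"
      using suminf_scaleR_right[OF sm, of r T] by (simp add: \<omega> bop_apply_scaleR cinner_scaleR_left)
    have "norm (\<omega> T) \<le> (\<Sum>n. norm T * (norm (x n) * norm (y n)))"
      unfolding \<omega> by (rule norm_suminf_le[OF bound summable_mult[OF xy]])
    then show "norm (\<omega> T) \<le> norm T * (\<Sum>n. norm (x n) * norm (y n))"
      using suminf_mult[OF xy] by simp
  qed
qed

lemma vector_functional_normal: "(\<lambda>T. cinner (bop_apply T x) y) \<in> normal_functionals"
proof -
  \<comment> \<open>Sequences supported at index 0, so that the series collapses to a single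
    term.\<close>
  define u v where "u = (\<lambda>n :: nat. if n = 0 then x else 0)" and "v = (\<lambda>n :: nat. if n = 0 then y else 0)"
  have "(\<Sum>n. cinner (bop_apply T (u n)) (v n)) = cinner (bop_apply T x) y" for T
  proof -
    have "cinner (bop_apply T 0) z = 0" for z
      using norm_bop_apply_le[of T 0] by simp
    then show ?thesis
      using suminf_finite[of "{0}" "\<lambda>n. cinner (bop_apply T (u n)) (v n)"]
      by (simp add: u_def v_def)
  qed
  moreover have "summable (\<lambda>n. (norm (u n))\<^sup>2)" "summable (\<lambda>n. (norm (v n))\<^sup>2)"
    by (rule summable_finite[of "{0}"]; simp add: u_def v_def)+
  ultimately show ?thesis
    unfolding normal_functionals_def by (intro CollectI exI[of _ u] exI[of _ v]) simp
qed

lemma topspace_weak_star [simp]: "topspace weak_star = UNIV"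
proof -
  \<comment> \<open>The space of a generated topology is the union of its generators; the preimage
    of \<open>UNIV\<close> under any one normal functional already fills it.\<close>
  have "UNIV \<in> {\<omega> -` U | \<omega> U. \<omega> \<in> (normal_functionals :: ('a bop \<Rightarrow> complex) set) \<and> open U}"
    using vector_functional_normal open_UNIV vimage_UNIV by blast
  then show ?thesis
    unfolding weak_star_def topology_generated_by_topspace by blast
qed

lemma continuous_map_vector_functional:
  "continuous_map weak_star euclidean (\<lambda>T. cinner (bop_apply T x) y)"
  unfolding continuous_map_alt
proof (intro conjI allI impI)
  fix U :: "complex set"
  assume "openin euclidean U"
  then show "openin weak_star ((\<lambda>T. cinner (bop_apply T x) y) -` U \<inter> topspace weak_star)"
    using vector_functional_normal[of x y] unfolding topspace_weak_star Int_UNIV_right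
    unfolding weak_star_def by (intro topology_generated_by_Basis) auto
qed simp

text \<open>Normal functionals are norm continuous, so every weak* generator is norm open: the norm
  topology is the finer one.\<close>

lemma continuous_map_euclidean_weak_star: "continuous_map euclidean weak_star (\<lambda>T. T)"
  unfolding weak_star_def
proof (rule continuous_on_generated_topo)
  fix V :: "'a bop set"
  assume "V \<in> {\<omega> -` U | \<omega> U. \<omega> \<in> normal_functionals \<and> open U}"
  then obtain \<omega> U where V: "V = \<omega> -` U" and \<omega>: "\<omega> \<in> normal_functionals" and U: "open U"
    by (elim CollectE exE conjE) (rule that)
  have "open V"
    unfolding V by (intro open_vimage U linear_continuous_on bounded_linear_normal_functional \<omega>)
  then show "openin euclidean ((\<lambda>T. T) -` V \<inter> topspace euclidean)"
    by simp
next
  have "\<Union>{\<omega> -` U | \<omega> U. \<omega> \<in> (normal_functionals :: ('a bop \<Rightarrow> complex) set) \<and> open U} = UNIV"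
    using topspace_weak_star[where 'a = 'a]
    unfolding weak_star_def topology_generated_by_topspace .
  then show "(\<lambda>T. T) ` topspace euclidean \<subseteq>
      \<Union>{\<omega> -` U | \<omega> U. \<omega> \<in> (normal_functionals :: ('a bop \<Rightarrow> complex) set) \<and> open U}"
    by (rule ssubst) (rule subset_UNIV)
qed

lemma closed_of_closedin_weak_star: "closedin weak_star C \<Longrightarrow> closed C"
  using closedin_continuous_map_preimage[OF continuous_map_euclidean_weak_star, of C] by simp

text \<open>For \<open>b \<ge> 0\<close> the ball is an intersection of preimages of closed discs
  under coefficient functionals; for \<open>b < 0\<close> it is empty.\<close>

lemma closedin_weak_star_norm_le: "closedin weak_star {T :: 'h::chilbert_space bop. norm T \<le> b}"
proof (cases "0 \<le> b")
  case True
  have "closedin weak_star {T. cmod (cinner (bop_apply T x) y) \<le> c}" for x y :: 'h and c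
    using closedin_continuous_map_preimage[OF continuous_map_vector_functional, of "cball 0 c" x y]
    by simp
  then have "closedin weak_star (\<Inter>x. \<Inter>y. {T :: 'h bop. cmod (cinner (bop_apply T x) y) \<le> b * norm x * norm y})"
    by (intro closedin_INT) simp_all
  also have "(\<Inter>x. \<Inter>y. {T :: 'h bop. cmod (cinner (bop_apply T x) y) \<le> b * norm x * norm y}) = {T. norm T \<le> b}"
    unfolding norm_bop_le_iff[OF True] by blast
  finally show ?thesis .
next
  case False
  then have "{T :: 'h bop. norm T \<le> b} = {}"
    using norm_ge_zero order_trans by blast
  then show ?thesis by simp
qed

section \<open>Norm boundedness and closed range of weak* continuous maps\<close>

lemma clinear_imp_linear: "clinear \<Phi> \<Longrightarrow> linear \<Phi>"
  unfolding Vector_Spaces.linear_iff by (rule linearI) (simp_all only: scaleR_scaleC)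

lemma weak_star_continuous_imp_bounded_linear:
  fixes \<Phi> :: "'h::chilbert_space bop \<Rightarrow> 'h bop"
  assumes lin: "linear \<Phi>" and cont: "continuous_map weak_star weak_star \<Phi>"
  shows "bounded_linear \<Phi>"
proof -
  define A where "A n = {T. norm (\<Phi> T) \<le> real n}" for n :: nat
  have A: "closed (A n)" for n
    using closedin_continuous_map_preimage[OF cont closedin_weak_star_norm_le]
    by (intro closed_of_closedin_weak_star) (simp add: A_def)
  have "(\<Union>n. A n) = UNIV"
    using real_arch_simple by (auto simp: A_def)
  then have "interior (\<Union>(range A)) \<noteq> {}"
    by simp
  \<comment> \<open>Baire's theorem in contrapositive form: if every \<open>A n\<close> had empty
    interior, so would their union.\<close>
  then obtain n where "interior (A n) \<noteq> {}"
    using Baire_category_alt[of "euclidean :: 'h bop topology" "range A"] A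
      completely_metrizable_space_euclidean
    by auto
  then obtain T0 r where r: "0 < r" and ball: "cball T0 r \<subseteq> A n"
    using mem_interior_cball by blast
  \<comment> \<open>The ball is moved to the origin by writing \<open>T\<close> as
    \<open>(T0 + T) - T0\<close>; each of the two terms contributes \<open>n\<close>.\<close>
  have small: "norm (\<Phi> T) \<le> 2 * n" if "norm T \<le> r" for T
  proof -
    have "T0 + T \<in> A n" "T0 \<in> A n"
      using ball r that by (auto simp: subset_iff dist_norm)
    moreover have "\<Phi> T = \<Phi> (T0 + T) - \<Phi> T0"
      by (simp add: linear_add[OF lin])
    ultimately show ?thesis
      using norm_triangle_ineq4[of "\<Phi> (T0 + T)" "\<Phi> T0"] by (simp add: A_def)
  qed
  have "norm (\<Phi> T) \<le> norm T * (2 * n / r)" for T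
  proof (cases "T = 0")
    case False
    \<comment> \<open>Rescales \<open>T\<close> to norm exactly \<open>r\<close>, the edge of the
      ball just treated.\<close>
    define t where "t = r / norm T"
    have t: "0 < t"
      using r False by (simp add: t_def)
    have "norm (t *\<^sub>R T) \<le> r"
      using r False by (simp add: t_def)
    then have "t * norm (\<Phi> T) \<le> 2 * n"
      using small[of "t *\<^sub>R T"] t by (simp add: linear_scale[OF lin])
    then show ?thesis
      using r False by (simp add: t_def field_simps)
  qed (simp add: linear_0[OF lin])
  then show ?thesis
    by (rule bounded_linear_intro[OF linear_add[OF lin] linear_scale[OF lin]])
qed

text \<open>The range of an idempotent is its fixed-point set. Testing the equation
  \<open>\<Phi> T = T\<close> on coefficients exhibits this set as an intersection of equalizers of
  continuous maps into the Hausdorff space of complex numbers.\<close>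

lemma closedin_range_idempotent:
  fixes \<Phi> :: "'h::chilbert_space bop \<Rightarrow> 'h bop"
  assumes cont: "continuous_map weak_star weak_star \<Phi>" and idem: "\<Phi> \<circ> \<Phi> = \<Phi>"
  shows "closedin weak_star (range \<Phi>)"
proof -
  have *: "closedin weak_star {T. cinner (bop_apply (\<Phi> T) x) y = cinner (bop_apply T x) y}" for x y
    using closedin_continuous_maps_eq[OF Hausdorff_space_euclidean
        continuous_map_compose[OF cont continuous_map_vector_functional[of x y]]
        continuous_map_vector_functional[of x y]]
    by (simp add: o_def)
  then have "closedin weak_star (\<Inter>x. \<Inter>y. {T. cinner (bop_apply (\<Phi> T) x) y = cinner (bop_apply T x) y})"
    by (intro closedin_INT) simp_all
  also have "(\<Inter>x. \<Inter>y. {T. cinner (bop_apply (\<Phi> T) x) y = cinner (bop_apply T x) y}) = {T. \<Phi> T = T}"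
    by (auto intro: bop_eqI[OF cinner_eqI])
  also have "\<dots> = range \<Phi>"
  proof (intro equalityI subsetI)
    fix T
    assume "T \<in> {T. \<Phi> T = T}"
    then show "T \<in> range \<Phi>"
      using rangeI[of \<Phi> T] by simp
  qed (use idem in \<open>auto simp: fun_eq_iff\<close>)
  finally show ?thesis .
qed

section \<open>The two distances and \<open>perp \<Phi>\<close>\<close>

lemma arveson_dist_nonneg:
  assumes "0 \<in> \<X>"
  shows "0 \<le> arveson_dist T \<X>"
  unfolding arveson_dist_def
proof (rule cSup_upper)
  \<comment> \<open>The competitor \<open>X = 0\<close> bounds every infimum by
    \<open>norm T\<close>, so the supremum is a genuine one and dominates the inserted 0.\<close>
  have "(INF X\<in>\<X>. norm (bop_apply T \<xi> - bop_apply X \<xi>)) \<le> norm T" if "norm \<xi> = 1" for \<xi>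
  proof -
    have "(INF X\<in>\<X>. norm (bop_apply T \<xi> - bop_apply X \<xi>)) \<le> norm (bop_apply T \<xi> - bop_apply 0 \<xi>)"
      by (rule cINF_lower[OF bdd_belowI2[of _ 0] assms]) simp
    also have "\<dots> \<le> norm T"
      using norm_bop_apply_le[of T \<xi>] that by simp
    finally show ?thesis .
  qed
  then show "bdd_above (insert 0 {INF X\<in>\<X>. norm (bop_apply T \<xi> - bop_apply X \<xi>) | \<xi>. norm \<xi> = 1})"
    by (intro bdd_aboveI[of _ "norm T"]) auto
qed simp

lemma op_dist_le: "X \<in> \<X> \<Longrightarrow> op_dist T \<X> \<le> norm (T - X)"
  unfolding op_dist_def by (rule cINF_lower[OF bdd_belowI2[of _ 0]]) simp_all

lemma norm_perp_le_op_dist: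
  assumes "bounded_linear \<Phi>" and idem: "\<Phi> \<circ> \<Phi> = \<Phi>"
  shows "norm (perp \<Phi> T) \<le> onorm (perp \<Phi>) * op_dist T (range \<Phi>)"
proof -
  interpret bounded_linear \<Phi> by fact
  have bl: "bounded_linear (perp \<Phi>)"
    unfolding perp_def by (intro bounded_linear_sub bounded_linear_ident assms(1))
  have *: "norm (perp \<Phi> T) \<le> onorm (perp \<Phi>) * norm (T - X)" if "X \<in> range \<Phi>" for X
  proof -
    have "\<Phi> X = X"
      using that idem by (auto simp: fun_eq_iff)
    then have "perp \<Phi> T = perp \<Phi> (T - X)"
      by (simp add: perp_def diff)
    then show ?thesis
      using onorm[OF bl, of "T - X"] by simp
  qed
  show ?thesis
  \<comment> \<open>Passing to the infimum over \<open>X\<close> requires dividing by the norm; if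
    it is 0, the bound for a single \<open>X\<close> already suffices.\<close>
  proof (cases "onorm (perp \<Phi>) = 0")
    case True
    then show ?thesis
      using *[OF rangeI] by simp
  next
    case False
    then have pos: "0 < onorm (perp \<Phi>)"
      using onorm_pos_le[OF bl] by simp
    then have "norm (perp \<Phi> T) / onorm (perp \<Phi>) \<le> op_dist T (range \<Phi>)"
      unfolding op_dist_def using * by (intro cINF_greatest) (auto simp: field_simps)
    then show ?thesis
      using pos by (simp add: field_simps)
  qed
qed

section \<open>Comparison of the admissible constants\<close>

theorem theorem3p8:
  fixes \<D> :: "'h::chilbert_space bop set"
    and \<Phi> :: "'h bop \<Rightarrow> 'h bop"
  assumes "separable_hilbert TYPE('h)"
    and "masa \<D>"
    and "\<Phi> \<in> schur_idempotents \<D>"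
  shows "(hyperreflexive (range \<Phi>) \<longleftrightarrow> \<Phi> \<in> frak_H \<D>) \<and>
    (hyperreflexive (range \<Phi>) \<longrightarrow> lambda_const \<Phi> \<le> k_const \<Phi> * onorm (perp \<Phi>))"
proof -
  have clin: "clinear \<Phi>" and cont: "continuous_map weak_star weak_star \<Phi>" and idem: "\<Phi> \<circ> \<Phi> = \<Phi>"
    using assms(3) by (auto simp: schur_idempotents_def schur_multipliers_def)
  let ?N = "onorm (perp \<Phi>)" and ?\<alpha> = "\<lambda>T. arveson_dist T (range \<Phi>)"
  \<comment> \<open>\<open>K\<close> and \<open>L\<close> collect the admissible constants whose
    infima are \<open>k_const \<Phi>\<close> and \<open>lambda_const \<Phi>\<close>.\<close>
  define K where "K = {k. k > 0 \<and> (\<forall>T. op_dist T (range \<Phi>) \<le> k * ?\<alpha> T)}"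
  define L where "L = {l. l > 0 \<and> (\<forall>T. norm (perp \<Phi> T) \<le> l * ?\<alpha> T)}"
  have bl: "bounded_linear \<Phi>"
    by (rule weak_star_continuous_imp_bounded_linear[OF clinear_imp_linear[OF clin] cont])
  then have N: "0 \<le> ?N"
    unfolding perp_def by (intro onorm_pos_le bounded_linear_sub bounded_linear_ident)
  have "\<Phi> 0 = 0"
    by (rule linear_0[OF clinear_imp_linear[OF clin]])
  then have \<alpha>: "0 \<le> ?\<alpha> T" for T
    using rangeI[of \<Phi> 0] by (simp add: arveson_dist_nonneg)
  have "csubspace (range \<Phi>)"
    using module_hom.subspace_image[OF Vector_Spaces.linear.axioms(3)[OF clin]]
      module.subspace_UNIV[OF vector_space_scaleC[folded module_iff_vector_space]] by this
  \<comment> \<open>Linearity and idempotence supply the subspace and closedness conditions, leaving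
    only the existence of a constant.\<close>
  then have hyp: "hyperreflexive (range \<Phi>) \<longleftrightarrow> K \<noteq> {}"
    using closedin_range_idempotent[OF cont idem]
    by (simp add: hyperreflexive_def K_def)
  have frak: "\<Phi> \<in> frak_H \<D> \<longleftrightarrow> L \<noteq> {}"
    using assms(3) by (simp add: frak_H_def L_def)
  \<comment> \<open>The slack \<open>e\<close> keeps the constant strictly positive even when
    \<open>?N = 0\<close>, that is, when \<open>\<Phi>\<close> is the identity.\<close>
  have KL: "?N * k + e \<in> L" if "k \<in> K" "0 < e" for k e
  proof -
    have k: "0 < k" and kT: "op_dist T (range \<Phi>) \<le> k * ?\<alpha> T" for T
      using that(1) by (auto simp: K_def)
    have "norm (perp \<Phi> T) \<le> (?N * k + e) * ?\<alpha> T" for T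
    proof -
      have "norm (perp \<Phi> T) \<le> ?N * op_dist T (range \<Phi>)"
        by (rule norm_perp_le_op_dist[OF bl idem])
      also have "\<dots> \<le> ?N * (k * ?\<alpha> T)"
        by (rule mult_left_mono[OF kT N])
      also have "\<dots> \<le> (?N * k + e) * ?\<alpha> T"
        using \<alpha>[of T] that(2) by (simp add: algebra_simps)
      finally show ?thesis .
    qed
    moreover have "0 < ?N * k + e"
      using N k that(2) by (simp add: add_nonneg_pos)
    ultimately show ?thesis
      by (simp add: L_def)
  qed
  \<comment> \<open>\<open>\<Phi> T\<close> is itself a competitor in the infimum defining
    \<open>op_dist\<close>.\<close>
  have LK: "L \<subseteq> K"
  proof
    fix l
    assume "l \<in> L"
    then have "0 < l" and l: "norm (T - \<Phi> T) \<le> l * ?\<alpha> T" for T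
      by (simp_all add: L_def perp_def)
    moreover have "op_dist T (range \<Phi>) \<le> l * ?\<alpha> T" for T
      using op_dist_le[OF rangeI[of \<Phi> T], of T] l[of T] by (rule order_trans)
    ultimately show "l \<in> K"
      by (simp add: K_def)
  qed
  have "Inf L \<le> Inf K * ?N" if "K \<noteq> {}"
  proof -
    \<comment> \<open>The slack is removed by letting \<open>e\<close> tend to 0.\<close>
    have *: "Inf L \<le> ?N * k" if "k \<in> K" for k
    proof (rule field_le_epsilon)
      fix e :: real
      assume "0 < e"
      then show "Inf L \<le> ?N * k + e"
        using KL[OF \<open>k \<in> K\<close>] by (intro cInf_lower bdd_belowI[of _ 0]) (auto simp: L_def)
    qed
    show ?thesis
    \<comment> \<open>The infimum over \<open>k\<close> is taken after dividing by
      \<open>?N\<close>. For \<open>?N = 0\<close> any single \<open>k\<close> from the nonempty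
      \<open>K\<close> gives \<open>Inf L \<le> 0\<close>.\<close>
    proof (cases "?N = 0")
      case True
      then show ?thesis using * that by auto
    next
      case False
      then have "0 < ?N" using N by simp
      then have "Inf L / ?N \<le> Inf K"
        using * that by (intro cInf_greatest) (auto simp: field_simps)
      then show ?thesis
        using \<open>0 < ?N\<close> by (simp add: field_simps)
    qed
  qed
  then have "lambda_const \<Phi> \<le> k_const \<Phi> * ?N" if "K \<noteq> {}"
    using that unfolding lambda_const_def k_const_def hyperreflexivity_const_def K_def L_def .
  moreover have "K \<noteq> {} \<longleftrightarrow> L \<noteq> {}"
    using KL[OF _ zero_less_one] LK by (metis ex_in_conv subset_empty)
  ultimately show ?thesis
    unfolding hyp frak by simp
qed

end
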